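(* Let $\mathcal{A}$ and $\mathcal{B}$ be 2-torsion free associative rings (not assumed unital) such that each of them is either semiprime or satisfies Condition (P). Let $\mathcal{M}$ be a 2-torsion free faithful $(\mathcal{A},\mathcal{B})$-bimodule such that $\{m\in\mathcal{M} : \mathcal{A}m=\{0\}\}=\{0\}$ and $\{m\in\mathcal{M} : m\mathcal{B}=\{0\}\}=\{0\}$. Let $\mathfrak{T}=Tri(\mathcal{A},\mathcal{M},\mathcal{B})$ be the associated triangular ring. If $\Psi:\mathfrak{T}\to\mathfrak{T}$ is a Jordan two-sided centralizer, then $\Psi$ is a (two-sided) centralizer on $\mathfrak{T}$.
   Context: Rings are associative and need not have a unity; modules are not assumed unital. An $(\mathcal{A},\mathcal{B})$-bimodule $\mathcal{M}$ is faithful if it is faithful as a left $\mathcal{A}$-module ($a\mathcal{M}=\{0\}$ implies $a=0$) and as a right $\mathcal{B}$-module ($\mathcal{M}b=\{0\}$ implies $b=0$). The triangular ring $Tri(\mathcal{A},\mathcal{M},\mathcal{B})$ is the set of all matrices $\begin{bmatrix} a & m\\ 0 & b\end{bmatrix}$ with $a\in\mathcal{A}$, $m\in\mathcal{M}$, $b\in\mathcal{B}$, under the usual matrix operations. A ring or module $R$ is 2-torsion free if $2x=0$ implies $x=0$. A ring $\mathcal{R}$ is semiprime if $x\mathcal{R}x=\{0\}$ implies $x=0$. A ring $\mathcal{R}$ satisfies Condition (P) if, for $a\in\mathcal{R}$, $xax=0$ for all $x\in\mathcal{R}$ implies $a=0$. An additive map $T:\mathcal{R}\to\mathcal{R}$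 is a Jordan two-sided centralizer if $T(x^2)=T(x)x=xT(x)$ for all $x\in\mathcal{R}$. It is a (two-sided) centralizer if $T(xy)=T(x)y=xT(y)$ for all $x,y\in\mathcal{R}$. *)

theory Defs
  imports Complex_Main
begin

text \<open>
  The class \<^class>\<open>ring\<close> consists of associative rings without a unity requirement, and is
  used for the two diagonal rings. Since there need not be an element \<open>2\<close>, the expression
  \<open>2x\<close> is written \<open>x + x\<close>.
\<close>

definition two_torsion_free :: "'a::ab_group_add itself \<Rightarrow> bool" where
  "two_torsion_free _ \<longleftrightarrow> (\<forall>x::'a. x + x = 0 \<longrightarrow> x = 0)"

definition semiprime_ring :: "'a::ring itself \<Rightarrow> bool" where
  "semiprime_ring _ \<longleftrightarrow> (\<forall>x::'a. (\<forall>r. x * r * x = 0) \<longrightarrow> x = 0)"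

definition condition_P :: "'a::ring itself \<Rightarrow> bool" where
  "condition_P _ \<longleftrightarrow> (\<forall>a::'a. (\<forall>x. x * a * x = 0) \<longrightarrow> a = 0)"

text \<open>
  The library's modules are unital and over commutative unital rings, hence the following
  locale for bimodules over possibly non-unital rings.
\<close>

locale rng_bimodule =
  fixes lact :: "'a::ring \<Rightarrow> 'm::ab_group_add \<Rightarrow> 'm"
    and ract :: "'m \<Rightarrow> 'b::ring \<Rightarrow> 'm"
  assumes lact_add_left: "lact (a + a') m = lact a m + lact a' m"
    and lact_add_right: "lact a (m + m') = lact a m + lact a m'"
    and lact_mult: "lact (a * a') m = lact a (lact a' m)"
    and ract_add_left: "ract (m + m') b = ract m b + ract m' b"
    and ract_add_right: "ract m (b + b') = ract m b + ract m b'"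
    and ract_mult: "ract m (b * b') = ract (ract m b) b'"
    and lact_ract: "ract (lact a m) b = lact a (ract m b)"

locale faithful_rng_bimodule = rng_bimodule +
  assumes faithful_left: "(\<And>m. lact a m = 0) \<Longrightarrow> a = 0"
    and faithful_right: "(\<And>m. ract m b = 0) \<Longrightarrow> b = 0"

text \<open>
  \<open>Tri a m b\<close> is the upper triangular matrix with diagonal entries \<open>a\<close>, \<open>b\<close> and off-diagonal
  entry \<open>m\<close>.
\<close>

datatype ('a, 'm, 'b) tri = Tri (tri11: 'a) (tri12: 'm) (tri22: 'b)

instantiation tri :: (ab_group_add, ab_group_add, ab_group_add) ab_group_add
begin

definition zero_tri :: "('a, 'b, 'c) tri" where
  "0 = Tri 0 0 0"

definition plus_tri :: "('a, 'b, 'c) tri \<Rightarrow> ('a, 'b, 'c) tri \<Rightarrow> ('a, 'b, 'c) tri" where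
  "x + y = Tri (tri11 x + tri11 y) (tri12 x + tri12 y) (tri22 x + tri22 y)"

definition uminus_tri :: "('a, 'b, 'c) tri \<Rightarrow> ('a, 'b, 'c) tri" where
  "- x = Tri (- tri11 x) (- tri12 x) (- tri22 x)"

definition minus_tri :: "('a, 'b, 'c) tri \<Rightarrow> ('a, 'b, 'c) tri \<Rightarrow> ('a, 'b, 'c) tri" where
  "x - y = Tri (tri11 x - tri11 y) (tri12 x - tri12 y) (tri22 x - tri22 y)"

instance
  by standard
    (auto simp: zero_tri_def plus_tri_def uminus_tri_def minus_tri_def add.assoc add.commute)

end

text \<open>
  Matrix multiplication depends on the two actions, so it is a function of them rather than
  an instance of \<^class>\<open>times\<close>.
\<close>

definition tri_mult ::
  "('a::ring \<Rightarrow> 'm::ab_group_add \<Rightarrow> 'm) \<Rightarrow> ('m \<Rightarrow> 'b::ring \<Rightarrow> 'm) \<Rightarrow>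
    ('a, 'm, 'b) tri \<Rightarrow> ('a, 'm, 'b) tri \<Rightarrow> ('a, 'm, 'b) tri" where
  "tri_mult lact ract x y =
    Tri (tri11 x * tri11 y) (lact (tri11 x) (tri12 y) + ract (tri12 x) (tri22 y))
      (tri22 x * tri22 y)"

lemma (in rng_bimodule) tri_ring:
  "class.ring (+) 0 (-) uminus (tri_mult lact ract)"
  by unfold_locales
    (auto simp: tri_mult_def plus_tri_def distrib_left distrib_right mult.assoc
      lact_add_left lact_add_right lact_mult ract_add_left ract_add_right ract_mult lact_ract
      ac_simps)

text \<open>
  Centralizers of a ring whose additive group is given by the type and whose multiplication
  is \<open>mul\<close>.
\<close>

definition jordan_two_sided_centralizer ::
  "('r::ab_group_add \<Rightarrow> 'r \<Rightarrow> 'r) \<Rightarrow> ('r \<Rightarrow> 'r) \<Rightarrow> bool" where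
  "jordan_two_sided_centralizer mul T \<longleftrightarrow>
    Modules.additive T \<and> (\<forall>x. T (mul x x) = mul (T x) x \<and> T (mul x x) = mul x (T x))"

definition two_sided_centralizer ::
  "('r::ab_group_add \<Rightarrow> 'r \<Rightarrow> 'r) \<Rightarrow> ('r \<Rightarrow> 'r) \<Rightarrow> bool" where
  "two_sided_centralizer mul T \<longleftrightarrow>
    Modules.additive T \<and> (\<forall>x y. T (mul x y) = mul (T x) y \<and> T (mul x y) = mul x (T y))"

end

theory Submission
  imports Defs
begin

text \<open>
  Polarising the Jordan identity gives
  \<open>\<Psi>(xy + yx) = \<Psi>(x)y + \<Psi>(y)x = x\<Psi>(y) + y\<Psi>(x)\<close>. The point is to apply this to \<open>x\<close> and
  \<open>y\<close> lying in two different corners \<open>\<A>\<close>, \<open>\<M>\<close>, \<open>\<B>\<close> of the triangular ring: there at most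
  one of \<open>xy\<close> and \<open>yx\<close> is nonzero, so the Jordan product is an ordinary product (or zero)
  and the identity has the strength of a centralizer identity.

  The pair \<open>(a, b)\<close>, with Jordan product zero, and the triviality of the annihilators of
  \<open>\<A>\<close>, \<open>\<B>\<close> and \<open>\<M>\<close> force \<open>\<Psi>\<close> to preserve the two diagonal corners
  (\<open>image_corner11\<close>, \<open>image_corner22\<close>). The pairs \<open>(m', mb)\<close> and \<open>(m', am)\<close> inside the
  off-diagonal corner, together with faithfulness, do the same for \<open>\<M>\<close>
  (\<open>image_corner12\<close>). Hence \<open>\<Psi>\<close> acts entrywise, by maps \<open>f\<close>, \<open>h\<close>, \<open>g\<close> say, and the pairs
  \<open>(a, m)\<close> and \<open>(m, b)\<close> yield \<open>h(am) = f(a)m = a h(m)\<close> and \<open>h(mb) = h(m)b = m g(b)\<close>.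
  These identities carry associativity of the actions over to \<open>f\<close> and \<open>g\<close>: for instance
  \<open>f(aa')m = h(aa'm) = f(a)a'm\<close> for every \<open>m\<close>, so \<open>f(aa') = f(a)a'\<close> by faithfulness.
\<close>

text \<open>
  Both \<open>xrx = (xr)x\<close> and \<open>rxr = r(xr)\<close> contain the factor \<open>xr = 0\<close>, so either alternative
  applies to \<open>x\<close>.
\<close>

lemma left_annihilator_trivial:
  fixes x :: "'r::ring"
  assumes "semiprime_ring TYPE('r) \<or> condition_P TYPE('r)"
    and "\<And>r. x * r = 0"
  shows "x = 0"
  using assms by (auto simp: semiprime_ring_def condition_P_def mult.assoc)

locale tri_jordan_centralizer = faithful_rng_bimodule lact ract
  for lact :: "'a::ring \<Rightarrow> 'm::ab_group_add \<Rightarrow> 'm"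
    and ract :: "'m \<Rightarrow> 'b::ring \<Rightarrow> 'm" +
  fixes \<Psi> :: "('a, 'm, 'b) tri \<Rightarrow> ('a, 'm, 'b) tri"
  assumes annihilator_a: "(\<And>r. x * r = 0) \<Longrightarrow> x = (0::'a)"
    and annihilator_b: "(\<And>r. y * r = 0) \<Longrightarrow> y = (0::'b)"
    and left_torsion_trivial: "(\<And>a. lact a m = 0) \<Longrightarrow> m = 0"
    and right_torsion_trivial: "(\<And>b. ract m b = 0) \<Longrightarrow> m = 0"
    and jordan: "jordan_two_sided_centralizer (tri_mult lact ract) \<Psi>"
begin

abbreviation mul (infixl "\<odot>" 70) where
  "x \<odot> y \<equiv> tri_mult lact ract x y"

sublocale tri: ring "(+)" "0 :: ('a, 'm, 'b) tri" "(-)" uminus "(\<odot>)"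
  by (rule tri_ring)

lemma act_zero [simp]:
  "lact 0 m = 0" "lact a 0 = 0" "ract 0 b = 0" "ract m 0 = 0"
  using lact_add_left[of 0 0 m] lact_add_right[of a 0 0]
    ract_add_left[of 0 0 b] ract_add_right[of m 0 0] by simp_all

lemma Psi_add: "\<Psi> (x + y) = \<Psi> x + \<Psi> y"
  using jordan by (simp add: jordan_two_sided_centralizer_def Modules.additive_def)

lemma Psi_zero: "\<Psi> 0 = 0"
  using Psi_add[of 0 0] by simp

lemma Psi_square: "\<Psi> (x \<odot> x) = \<Psi> x \<odot> x" "\<Psi> (x \<odot> x) = x \<odot> \<Psi> x"
  using jordan unfolding jordan_two_sided_centralizer_def by blast+

lemma Psi_jordan_product:
  shows "\<Psi> (x \<odot> y + y \<odot> x) = \<Psi> x \<odot> y + \<Psi> y \<odot> x"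
    and "\<Psi> (x \<odot> y + y \<odot> x) = x \<odot> \<Psi> y + y \<odot> \<Psi> x"
proof -
  have square: "(x + y) \<odot> (x + y) = x \<odot> x + (x \<odot> y + y \<odot> x) + y \<odot> y"
    by (simp add: tri.distrib_left tri.distrib_right add_ac)
  have "\<Psi> x \<odot> x + \<Psi> (x \<odot> y + y \<odot> x) + \<Psi> y \<odot> y = (\<Psi> x + \<Psi> y) \<odot> (x + y)"
    using Psi_square(1)[of "x + y"] unfolding square
    by (simp add: Psi_add Psi_square(1))
  then show "\<Psi> (x \<odot> y + y \<odot> x) = \<Psi> x \<odot> y + \<Psi> y \<odot> x"
    by (simp add: tri.distrib_left tri.distrib_right algebra_simps)
  have "x \<odot> \<Psi> x + \<Psi> (x \<odot> y + y \<odot> x) + y \<odot> \<Psi> y = (x + y) \<odot> (\<Psi> x + \<Psi> y)"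
    using Psi_square(2)[of "x + y"] unfolding square
    by (simp add: Psi_add Psi_square(2))
  then show "\<Psi> (x \<odot> y + y \<odot> x) = x \<odot> \<Psi> y + y \<odot> \<Psi> x"
    by (simp add: tri.distrib_left tri.distrib_right algebra_simps)
qed

definition f where "f a = tri11 (\<Psi> (Tri a 0 0))"
definition h where "h m = tri12 (\<Psi> (Tri 0 m 0))"
definition g where "g b = tri22 (\<Psi> (Tri 0 0 b))"

text \<open>
  Both expansions of \<open>\<Psi>(ab + ba) = 0\<close> for \<open>a\<close>, \<open>b\<close> in opposite diagonal corners.
  Each stray entry of \<open>\<Psi>(a)\<close> and \<open>\<Psi>(b)\<close> is thereby killed by a whole corner.
\<close>

lemma opposite_corners:
  "tri12 (\<Psi> (Tri a 0 0)) = 0" "tri22 (\<Psi> (Tri a 0 0)) = 0"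
  "tri11 (\<Psi> (Tri 0 0 b)) = 0" "tri12 (\<Psi> (Tri 0 0 b)) = 0"
proof -
  have *: "tri11 (\<Psi> (Tri 0 0 b)) * a = 0 \<and> ract (tri12 (\<Psi> (Tri a 0 0))) b = 0
      \<and> tri22 (\<Psi> (Tri a 0 0)) * b = 0 \<and> lact a (tri12 (\<Psi> (Tri 0 0 b))) = 0" for a b
    using Psi_jordan_product[of "Tri a 0 0" "Tri 0 0 b"] Psi_zero
    by (simp add: tri_mult_def plus_tri_def zero_tri_def)
  show "tri12 (\<Psi> (Tri a 0 0)) = 0" "tri22 (\<Psi> (Tri a 0 0)) = 0"
    "tri11 (\<Psi> (Tri 0 0 b)) = 0" "tri12 (\<Psi> (Tri 0 0 b)) = 0"
    using * right_torsion_trivial annihilator_b annihilator_a left_torsion_trivial by blast+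
qed

lemma image_corner11: "\<Psi> (Tri a 0 0) = Tri (f a) 0 0"
  by (simp add: f_def opposite_corners tri.expand)

lemma image_corner22: "\<Psi> (Tri 0 0 b) = Tri 0 0 (g b)"
  by (simp add: g_def opposite_corners tri.expand)

text \<open>
  Products within \<open>\<M>\<close> vanish, so \<open>p(m)m' + p(m')m = 0\<close> for the \<open>\<A>\<close>-component \<open>p\<close> of
  \<open>\<Psi>\<close> on \<open>\<M>\<close>. Since \<open>p(mb) = 0\<close>, replacing \<open>m\<close> by \<open>mb\<close> leaves the single term
  \<open>p(m')mb = 0\<close>; cancelling first \<open>b\<close> and then \<open>m\<close> gives \<open>p = 0\<close>. The \<open>\<B>\<close>-component is
  treated symmetrically, with \<open>am\<close> in place of \<open>mb\<close>.
\<close>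

lemma image_corner12: "\<Psi> (Tri 0 m 0) = Tri 0 (h m) 0"
proof -
  define p where "p m = tri11 (\<Psi> (Tri 0 m 0))" for m
  define q where "q m = tri22 (\<Psi> (Tri 0 m 0))" for m
  have polar: "lact (p m) m' + lact (p m') m = 0" "ract m (q m') + ract m' (q m) = 0" for m m'
    using Psi_jordan_product[of "Tri 0 m 0" "Tri 0 m' 0"] Psi_zero
    by (simp_all add: tri_mult_def plus_tri_def zero_tri_def p_def q_def)
  have p_ract: "p (ract m b) = 0" for m b
    using Psi_jordan_product(1)[of "Tri 0 m 0" "Tri 0 0 b"]
    by (simp add: tri_mult_def plus_tri_def p_def image_corner22)
  have q_lact: "q (lact a m) = 0" for m a
    using Psi_jordan_product(1)[of "Tri a 0 0" "Tri 0 m 0"]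
    by (simp add: tri_mult_def plus_tri_def q_def image_corner11)
  have "ract (lact (p m') m) b = 0" for m' m b
    using polar(1)[of "ract m b" m'] by (simp add: p_ract lact_ract)
  then have "p m = 0" for m
    using right_torsion_trivial faithful_left by blast
  moreover have "lact a (ract m (q m')) = 0" for m' m a
    using polar(2)[of "lact a m" m'] by (simp add: q_lact lact_ract)
  then have "q m = 0" for m
    using left_torsion_trivial faithful_right by blast
  ultimately show ?thesis
    by (simp add: p_def q_def h_def tri.expand)
qed

lemma Psi_entrywise: "\<Psi> (Tri a m b) = Tri (f a) (h m) (g b)"
proof -
  have "Tri a m b = Tri a 0 0 + Tri 0 m 0 + Tri 0 0 b"
    by (simp add: plus_tri_def)
  then show ?thesis
    by (simp only: Psi_add image_corner11 image_corner12 image_corner22) (simp add: plus_tri_def)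
qed

lemma h_lact: "h (lact a m) = lact (f a) m" "h (lact a m) = lact a (h m)"
  using Psi_jordan_product[of "Tri a 0 0" "Tri 0 m 0"]
  by (simp_all add: tri_mult_def plus_tri_def image_corner11 image_corner12)

lemma h_ract: "h (ract m b) = ract (h m) b" "h (ract m b) = ract m (g b)"
  using Psi_jordan_product[of "Tri 0 m 0" "Tri 0 0 b"]
  by (simp_all add: tri_mult_def plus_tri_def image_corner22 image_corner12)

lemma h_add: "h (m + m') = h m + h m'"
  using Psi_add[of "Tri 0 m 0" "Tri 0 m' 0"] by (simp add: plus_tri_def image_corner12)

text \<open>Faithfulness, in the form in which it cancels \<open>m\<close> from an identity.\<close>

lemma lact_cancel:
  assumes "\<And>m. lact a m = lact a' m"
  shows "a = a'"
proof -
  have "lact (a - a') m = 0" for m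
    using lact_add_left[of "a - a'" a' m] assms[of m] by simp
  then show ?thesis
    using faithful_left by fastforce
qed

lemma ract_cancel:
  assumes "\<And>m. ract m b = ract m b'"
  shows "b = b'"
proof -
  have "ract m (b - b') = 0" for m
    using ract_add_right[of m "b - b'" b'] assms[of m] by simp
  then show ?thesis
    using faithful_right by fastforce
qed

lemma f_mult: "f (a * a') = f a * a'" "f (a * a') = a * f a'"
  by (rule lact_cancel, metis h_lact lact_mult)+

lemma g_mult: "g (b * b') = g b * b'" "g (b * b') = b * g b'"
  by (rule ract_cancel, metis h_ract ract_mult)+

lemma Psi_centralizer: "two_sided_centralizer (\<odot>) \<Psi>"
proof -
  have "\<Psi> (x \<odot> y) = \<Psi> x \<odot> y \<and> \<Psi> (x \<odot> y) = x \<odot> \<Psi> y" for x y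
    by (cases x; cases y)
      (simp add: tri_mult_def Psi_entrywise h_add, metis f_mult g_mult h_lact h_ract)
  then show ?thesis
    using jordan unfolding two_sided_centralizer_def jordan_two_sided_centralizer_def by blast
qed

end

theorem theorem2p2:
  fixes lact :: "'a::ring \<Rightarrow> 'm::ab_group_add \<Rightarrow> 'm"
    and ract :: "'m \<Rightarrow> 'b::ring \<Rightarrow> 'm"
    and \<Psi> :: "('a, 'm, 'b) tri \<Rightarrow> ('a, 'm, 'b) tri"
  assumes "two_torsion_free TYPE('a)"
    and "two_torsion_free TYPE('b)"
    and "semiprime_ring TYPE('a) \<or> condition_P TYPE('a)"
    and "semiprime_ring TYPE('b) \<or> condition_P TYPE('b)"
    and "faithful_rng_bimodule lact ract"
    and "two_torsion_free TYPE('m)"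
    and "{m. \<forall>a. lact a m = 0} = {0}"
    and "{m. \<forall>b. ract m b = 0} = {0}"
    and "jordan_two_sided_centralizer (tri_mult lact ract) \<Psi>"
  shows "two_sided_centralizer (tri_mult lact ract) \<Psi>"
proof -
  interpret faithful_rng_bimodule lact ract by fact
  interpret tri_jordan_centralizer lact ract \<Psi>
    using assms(7-9) left_annihilator_trivial[OF assms(3)] left_annihilator_trivial[OF assms(4)]
    by unfold_locales auto
  show ?thesis
    by (rule Psi_centralizer)
qed

end
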